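(* Let $G$ be a finite group, $m$ a positive integer, and let $\Gamma=\mathrm{Cay}(G,S_{i,j}:1\le i,j\le m)$ be an $m$-Cayley digraph (respectively, $m$-Cayley graph) of $G$. Then $\Gamma$ is $m$CI if and only if every semiregular subgroup of $\mathrm{Aut}(\Gamma)$ isomorphic to $G$ is conjugate to $R(G)$ in $\mathrm{Aut}(\Gamma)$.
   Context: Digraphs are finite without loops or multiple arcs; a graph is a digraph with symmetric arc set. A permutation group is semiregular if all point stabilizers are trivial. $V=\bigcup_{i=1}^m G_i$ is a disjoint union of copies $G_i=\{x_i:x\in G\}$ of $G$. For subsets $S_{i,j}\subseteq G$ ($1\le i,j\le m$) with $1\notin S_{i,i}$, the $m$-Cayley digraph $\mathrm{Cay}(G,S_{i,j}:1\le i,j\le m)$ has vertex set $V$ and arc set $\bigcup_{i,j}\{(x_i,(sx)_j): s\in S_{i,j},x\in G\}$; it is an $m$-Cayley graph if it is a graph, i.e. $S_{i,j}=S_{j,i}^{-1}$ for all $i,j$. $R(G)=\{R(g):g\in G\}$ with $R(g):x_i\mapsto(xg)_i$ for all $x\in G$ and all $i$, and $N=N_{\mathrm{S}_V}(R(G))$ is its normalizer in the symmetric group on $V$. For a permutation $n$ of $V$, $\Gamma^n$ is the digraph with vertex set $V$ and arcs $(u^n,v^n)$ for $(u,v)$ an arc of $\Gamma$. An $m$-Cayley (di)graph $\Gamma$ of $G$ is called $m$CI if for every $m$-Cayley (di)graph $\Sigma$ of $G$ isomorphic to $\Gamma$ there is $n\in N$ with $\Gamma^n=\Sigma$. *)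

theory Defs
  imports
    "HOL-Algebra.Algebra"
    "Graph_Theory.Graph_Theory"
begin

text \<open>The vertex \<open>x\<^sub>i\<close>, the element \<open>x\<close> of the copy \<open>G\<^sub>i\<close>, is the pair \<open>(x, i)\<close>.\<close>

definition mcay_verts :: "('a, 'b) monoid_scheme \<Rightarrow> nat \<Rightarrow> ('a \<times> nat) set" where
  "mcay_verts G m = carrier G \<times> {1..m}"

definition connection_family ::
  "('a, 'b) monoid_scheme \<Rightarrow> nat \<Rightarrow> (nat \<Rightarrow> nat \<Rightarrow> 'a set) \<Rightarrow> bool" where
  "connection_family G m S \<longleftrightarrow>
     (\<forall>i\<in>{1..m}. \<forall>j\<in>{1..m}. S i j \<subseteq> carrier G) \<and>
     (\<forall>i\<in>{1..m}. \<one>\<^bsub>G\<^esub> \<notin> S i i)"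

definition mCay ::
  "('a, 'b) monoid_scheme \<Rightarrow> nat \<Rightarrow> (nat \<Rightarrow> nat \<Rightarrow> 'a set) \<Rightarrow> ('a \<times> nat) pair_pre_digraph" where
  "mCay G m S =
     \<lparr> pverts = mcay_verts G m,
       parcs = (\<Union>i\<in>{1..m}. \<Union>j\<in>{1..m}.
                  {((x, i), (s \<otimes>\<^bsub>G\<^esub> x, j)) | s x. s \<in> S i j \<and> x \<in> carrier G}) \<rparr>"

definition is_mcayley_digraph ::
  "('a, 'b) monoid_scheme \<Rightarrow> nat \<Rightarrow> ('a \<times> nat) pair_pre_digraph \<Rightarrow> bool" where
  "is_mcayley_digraph G m \<Gamma> \<longleftrightarrow> (\<exists>S. connection_family G m S \<and> \<Gamma> = mCay G m S)"

definition is_mcayley_graph ::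
  "('a, 'b) monoid_scheme \<Rightarrow> nat \<Rightarrow> ('a \<times> nat) pair_pre_digraph \<Rightarrow> bool" where
  "is_mcayley_graph G m \<Gamma> \<longleftrightarrow> is_mcayley_digraph G m \<Gamma> \<and> pair_graph \<Gamma>"

text \<open>Permutations of a set \<open>V\<close> are the elements of \<open>BijGroup V\<close>. Its product is composition of
  functions acting on the left, the reverse of the product for the exponent notation \<open>v\<^sup>n\<close>. The
  subgroups, normalizers and conjugacy classes of subgroups are the same for both products, and
  inversion is an isomorphism between them.\<close>

definition right_mult ::
  "('a, 'b) monoid_scheme \<Rightarrow> nat \<Rightarrow> 'a \<Rightarrow> 'a \<times> nat \<Rightarrow> 'a \<times> nat" where
  "right_mult G m g = (\<lambda>(x, i)\<in>mcay_verts G m. (x \<otimes>\<^bsub>G\<^esub> g, i))"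

definition right_regular ::
  "('a, 'b) monoid_scheme \<Rightarrow> nat \<Rightarrow> ('a \<times> nat \<Rightarrow> 'a \<times> nat) set" where
  "right_regular G m = right_mult G m ` carrier G"

definition semiregular :: "'v set \<Rightarrow> ('v \<Rightarrow> 'v) set \<Rightarrow> bool" where
  "semiregular V H \<longleftrightarrow>
     (\<forall>v\<in>V. stabilizer (BijGroup V\<lparr>carrier := H\<rparr>) (\<lambda>h. h) v = {\<one>\<^bsub>BijGroup V\<^esub>})"

definition digraph_perm_image ::
  "('v \<Rightarrow> 'v) \<Rightarrow> 'v pair_pre_digraph \<Rightarrow> 'v pair_pre_digraph" where
  "digraph_perm_image n \<Gamma> =
     \<lparr> pverts = pverts \<Gamma>, parcs = {(n u, n v) | u v. (u, v) \<in> parcs \<Gamma>} \<rparr>"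

definition DigraphAut :: "'v pair_pre_digraph \<Rightarrow> ('v \<Rightarrow> 'v) monoid" where
  "DigraphAut \<Gamma> = BijGroup (pverts \<Gamma>)
     \<lparr>carrier := {p \<in> Bij (pverts \<Gamma>). \<forall>u\<in>pverts \<Gamma>. \<forall>v\<in>pverts \<Gamma>.
                    (p u, p v) \<in> parcs \<Gamma> \<longleftrightarrow> (u, v) \<in> parcs \<Gamma>}\<rparr>"

definition conjugate_in :: "('g, 'b) monoid_scheme \<Rightarrow> 'g set \<Rightarrow> 'g set \<Rightarrow> bool" where
  "conjugate_in A H K \<longleftrightarrow> (\<exists>a\<in>carrier A. K = a <#\<^bsub>A\<^esub> H #>\<^bsub>A\<^esub> inv\<^bsub>A\<^esub> a)"

definition mCI_digraph ::
  "('a, 'b) monoid_scheme \<Rightarrow> nat \<Rightarrow> ('a \<times> nat) pair_pre_digraph \<Rightarrow> bool" where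
  "mCI_digraph G m \<Gamma> \<longleftrightarrow>
     is_mcayley_digraph G m \<Gamma> \<and>
     (\<forall>\<Sigma>. is_mcayley_digraph G m \<Sigma> \<and> digraph_iso (with_proj \<Gamma>) (with_proj \<Sigma>) \<longrightarrow>
        (\<exists>n\<in>normalizer (BijGroup (mcay_verts G m)) (right_regular G m).
           digraph_perm_image n \<Gamma> = \<Sigma>))"

definition mCI_graph ::
  "('a, 'b) monoid_scheme \<Rightarrow> nat \<Rightarrow> ('a \<times> nat) pair_pre_digraph \<Rightarrow> bool" where
  "mCI_graph G m \<Gamma> \<longleftrightarrow>
     is_mcayley_graph G m \<Gamma> \<and>
     (\<forall>\<Sigma>. is_mcayley_graph G m \<Sigma> \<and> digraph_iso (with_proj \<Gamma>) (with_proj \<Sigma>) \<longrightarrow>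
        (\<exists>n\<in>normalizer (BijGroup (mcay_verts G m)) (right_regular G m).
           digraph_perm_image n \<Gamma> = \<Sigma>))"

end

theory Submission
  imports Defs
begin

text \<open>
  Write \<open>V\<close> for the vertex set, \<open>B\<close> for the symmetric group on \<open>V\<close>, \<open>R\<close> for the right
  regular group and \<open>A\<close> for the automorphism group of \<open>\<Gamma>\<close>. The argument is the one that
  Babai gave for Cayley graphs, and it rests on two observations.

  First, a loopless digraph on \<open>V\<close> is \<open>m\<close>-Cayley exactly when \<open>R\<close> acts on it by automorphisms:
  the arcs that leave the vertices \<open>(\<one>, i)\<close> are the connection sets, and \<open>R\<close> moves them to all
  other vertices (\<open>is_mcayley_digraph_iff\<close>).

  Second, the semiregular subgroups of \<open>B\<close> isomorphic to \<open>G\<close> are exactly the conjugates of \<open>R\<close>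
  in \<open>B\<close>: a free action of \<open>G\<close> on a set with \<open>m\<close> times as many elements as \<open>G\<close> has \<open>m\<close> orbits,
  each of them a copy of \<open>G\<close>, and hence is a relabelling of the action on \<open>V\<close>
  (\<open>semiregular_iff_conjugate_right_regular\<close>).

  The subgroups of \<open>A\<close> in question are therefore the conjugates \<open>p R p\<inverse>\<close> that lie in \<open>A\<close>.
  By the first observation, a permutation \<open>p\<close> for which \<open>p R p\<inverse>\<close> lies in \<open>A\<close> amounts to an \<open>m\<close>-Cayley digraph isomorphic
  to \<open>\<Gamma>\<close>, namely the image of \<open>\<Gamma>\<close> under \<open>p\<inverse>\<close>. An element \<open>n\<close> of the normalizer of \<open>R\<close> has that
  same image if and only if \<open>p n\<close> is an automorphism of \<open>\<Gamma>\<close>, and then \<open>(p n)\<inverse>\<close> conjugates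
  \<open>p R p\<inverse>\<close> to \<open>R\<close>; conversely every automorphism that conjugates \<open>p R p\<inverse>\<close> to \<open>R\<close> arises in this way
  (\<open>mCI_digraph_iff_conjugates\<close>).

  For graphs nothing changes, because a digraph isomorphic to a graph is a graph
  (\<open>mCI_graph_iff_mCI_digraph\<close>).
\<close>

section \<open>Conjugation in a group\<close>

abbreviation conj_set :: "('g, 'b) monoid_scheme \<Rightarrow> 'g \<Rightarrow> 'g set \<Rightarrow> 'g set" where
  "conj_set A a H \<equiv> a <#\<^bsub>A\<^esub> H #>\<^bsub>A\<^esub> inv\<^bsub>A\<^esub> a"

lemma conj_set_eq_image:
  "conj_set A a H = (\<lambda>h. a \<otimes>\<^bsub>A\<^esub> h \<otimes>\<^bsub>A\<^esub> inv\<^bsub>A\<^esub> a) ` H"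
  by (auto simp: l_coset_def r_coset_def)

context group
begin

lemma conj_set_conj_set:
  assumes "a \<in> carrier G" and "b \<in> carrier G" and "H \<subseteq> carrier G"
  shows "conj_set G a (conj_set G b H) = conj_set G (a \<otimes> b) H"
  unfolding conj_set_eq_image image_image
  using assms by (intro image_cong) (auto simp: m_assoc inv_mult_group subset_iff)

lemma conj_set_one:
  assumes "H \<subseteq> carrier G"
  shows "conj_set G \<one> H = H"
proof -
  have "(\<lambda>h. \<one> \<otimes> h \<otimes> inv \<one>) ` H = (\<lambda>h. h) ` H"
    using assms by (intro image_cong) auto
  then show ?thesis unfolding conj_set_eq_image by simp
qed

lemma conj_set_subset:
  assumes "a \<in> carrier G" and "H \<subseteq> carrier G"
  shows "conj_set G a H \<subseteq> carrier G"
  using assms by (auto simp: conj_set_eq_image)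

lemma conj_set_inv_eq_iff:
  assumes "a \<in> carrier G" and "H \<subseteq> carrier G" and "K \<subseteq> carrier G"
  shows "conj_set G (inv a) K = H \<longleftrightarrow> K = conj_set G a H"
  using assms conj_set_conj_set conj_set_one
  by (metis inv_closed l_inv r_inv conj_set_subset)

lemma mem_normalizer_iff:
  assumes "H \<subseteq> carrier G"
  shows "n \<in> normalizer G H \<longleftrightarrow> n \<in> carrier G \<and> conj_set G n H = H"
  using assms by (auto simp: normalizer_def stabilizer_def)

end

section \<open>Free actions have coordinates\<close>

lemma carrier_BijGroup [simp]: "carrier (BijGroup V) = Bij V"
  by (simp add: BijGroup_def)

lemma one_BijGroup: "\<one>\<^bsub>BijGroup V\<^esub> = (\<lambda>v\<in>V. v)"
  by (simp add: BijGroup_def)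

lemma mult_BijGroup_apply:
  assumes "p \<in> Bij V" and "q \<in> Bij V" and "v \<in> V"
  shows "(p \<otimes>\<^bsub>BijGroup V\<^esub> q) v = p (q v)"
  using assms by (simp add: BijGroup_def compose_def)

lemma Bij_apply_mem: "p \<in> Bij V \<Longrightarrow> v \<in> V \<Longrightarrow> p v \<in> V"
  using Bij_imp_funcset by blast

lemma Bij_image: "p \<in> Bij V \<Longrightarrow> p ` V = V"
  by (simp add: Bij_def bij_betw_def)

lemma Bij_eqI:
  assumes "p \<in> Bij V" and "q \<in> Bij V" and "\<And>v. v \<in> V \<Longrightarrow> p v = q v"
  shows "p = q"
  using assms by (meson Bij_imp_extensional extensionalityI)

lemma Bij_apply_eq_iff:
  assumes "p \<in> Bij V" and "u \<in> V" and "v \<in> V"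
  shows "p u = p v \<longleftrightarrow> u = v"
  using assms by (auto simp: Bij_def bij_betw_def inj_on_eq_iff)

definition free_action :: "('g, 'b) monoid_scheme \<Rightarrow> 'v set \<Rightarrow> ('g \<Rightarrow> 'v \<Rightarrow> 'v) \<Rightarrow> bool" where
  "free_action G V \<phi> \<longleftrightarrow>
     group_action G V \<phi> \<and> (\<forall>g\<in>carrier G. \<forall>v\<in>V. \<phi> g v = v \<longrightarrow> g = \<one>\<^bsub>G\<^esub>)"

text \<open>Pick one point \<open>t\<close> in each orbit. Every point of the orbit is \<open>\<phi> g t\<close> for a single \<open>g\<close> because
  point stabilizers are trivial. The parametrization uses \<open>x = g\<inverse>\<close> so that the left action
  of \<open>G\<close> becomes multiplication on the right in the coordinate \<open>x\<close>.\<close>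

lemma free_action_transversal:
  assumes "free_action G V \<phi>"
  obtains T where "T \<subseteq> V"
    and "bij_betw (\<lambda>(x, t). \<phi> (inv\<^bsub>G\<^esub> x) t) (carrier G \<times> T) V"
proof -
  interpret group_action G V \<phi>
    using assms by (simp add: free_action_def)
  interpret G: group G
    using group_hom group_hom.axioms(1) by blast
  have free: "g = \<one>\<^bsub>G\<^esub>" if "g \<in> carrier G" "v \<in> V" "\<phi> g v = v" for g v
    using assms that by (auto simp: free_action_def)
  define r where "r v = (SOME w. w \<in> Group_Action.orbit G \<phi> v)" for v
  have r: "r v \<in> Group_Action.orbit G \<phi> v" if "v \<in> V" for v
    unfolding r_def using orbit_refl[OF that] by (rule someI)
  have orbit_V: "w \<in> V" if "v \<in> V" "w \<in> Group_Action.orbit G \<phi> v" for v w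
    using that element_image by (auto simp: Group_Action.orbit_def)
  have orbit_eq: "Group_Action.orbit G \<phi> w = Group_Action.orbit G \<phi> v"
    if "v \<in> V" "w \<in> Group_Action.orbit G \<phi> v" for v w
    using that orbit_V orbit_sym orbit_trans by blast
  have r_eq: "r w = r v" if "v \<in> V" "w \<in> Group_Action.orbit G \<phi> v" for v w
    using orbit_eq[OF that] by (simp add: r_def)
  have rV: "r v \<in> V" if "v \<in> V" for v
    using r orbit_V that by blast
  have rr: "r t = t" if "t \<in> r ` V" for t
  proof -
    obtain v where "v \<in> V" "t = r v" using \<open>t \<in> r ` V\<close> by blast
    then show "r t = t" using r_eq[OF _ r] by simp
  qed
  have act: "\<phi> g t \<in> V" "r (\<phi> g t) = t" if "g \<in> carrier G" "t \<in> r ` V" for g t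
  proof -
    have "t \<in> V" using that rV by auto
    then show "\<phi> g t \<in> V" using element_image that by blast
    have "\<phi> g t \<in> Group_Action.orbit G \<phi> t" using that by (auto simp: Group_Action.orbit_def)
    then show "r (\<phi> g t) = t" using r_eq[OF \<open>t \<in> V\<close>] rr[OF \<open>t \<in> r ` V\<close>] by simp
  qed
  have "inj_on (\<lambda>(x, t). \<phi> (inv\<^bsub>G\<^esub> x) t) (carrier G \<times> r ` V)"
  proof (rule inj_onI, clarify)
    fix x y s t
    assume x: "x \<in> carrier G" and y: "y \<in> carrier G" and "s \<in> V" and "t \<in> V"
      and eq: "\<phi> (inv\<^bsub>G\<^esub> x) (r s) = \<phi> (inv\<^bsub>G\<^esub> y) (r t)"
    have st: "r s = r t"
      using act(2)[of "inv\<^bsub>G\<^esub> x" "r s"] act(2)[of "inv\<^bsub>G\<^esub> y" "r t"] eq x y \<open>s \<in> V\<close> \<open>t \<in> V\<close>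
      by simp
    have "\<phi> (y \<otimes>\<^bsub>G\<^esub> inv\<^bsub>G\<^esub> x) (r s) = \<phi> y (\<phi> (inv\<^bsub>G\<^esub> y) (r s))"
      using eq st x y rV[OF \<open>s \<in> V\<close>] by (simp add: composition_rule)
    also have "\<dots> = \<phi> (y \<otimes>\<^bsub>G\<^esub> inv\<^bsub>G\<^esub> y) (r s)"
      using y rV[OF \<open>s \<in> V\<close>] by (intro composition_rule[symmetric]) auto
    also have "\<dots> = r s"
      using y rV[OF \<open>s \<in> V\<close>] by (simp flip: id_eq_one)
    finally have "y \<otimes>\<^bsub>G\<^esub> inv\<^bsub>G\<^esub> x = \<one>\<^bsub>G\<^esub>"
      using x y rV[OF \<open>s \<in> V\<close>] by (intro free) auto
    then show "x = y \<and> r s = r t"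
      using st x y G.inv_equality[of y "inv\<^bsub>G\<^esub> x"] by simp
  qed
  moreover have "(\<lambda>(x, t). \<phi> (inv\<^bsub>G\<^esub> x) t) ` (carrier G \<times> r ` V) = V"
  proof (intro equalityI subsetI)
    fix v assume v: "v \<in> V"
    then obtain g where g: "g \<in> carrier G" "\<phi> g v = r v"
      using r[OF v] unfolding Group_Action.orbit_def by force
    then have "\<phi> (inv\<^bsub>G\<^esub> g) (r v) = v"
      using orbit_sym_aux v by blast
    then show "v \<in> (\<lambda>(x, t). \<phi> (inv\<^bsub>G\<^esub> x) t) ` (carrier G \<times> r ` V)"
      using g v by force
  qed (use act in auto)
  ultimately show thesis
    using rV by (intro that[of "r ` V"]) (auto simp: bij_betw_def)
qed

text \<open>Counting shows that a transversal has \<open>m\<close> points. Numbering them turns the parametrization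
  by orbit representatives into one by \<open>m\<close> copies of \<open>G\<close>, on which \<open>g\<inverse>\<close> acts as right
  multiplication by \<open>g\<close>.\<close>

lemma free_action_coordinates:
  assumes "free_action G V \<phi>" and "finite (carrier G)" and "finite V"
    and "card V = card (carrier G) * m"
  obtains p where "bij_betw p (mcay_verts G m) V"
    and "\<And>x g i. x \<in> carrier G \<Longrightarrow> g \<in> carrier G \<Longrightarrow> i \<in> {1..m} \<Longrightarrow>
           p (x \<otimes>\<^bsub>G\<^esub> g, i) = \<phi> (inv\<^bsub>G\<^esub> g) (p (x, i))"
proof -
  interpret group_action G V \<phi>
    using assms by (simp add: free_action_def)
  interpret G: group G
    using group_hom group_hom.axioms(1) by blast
  obtain T where T: "T \<subseteq> V"
    and bij: "bij_betw (\<lambda>(x, t). \<phi> (inv\<^bsub>G\<^esub> x) t) (carrier G \<times> T) V"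
    using free_action_transversal[OF assms(1)] .
  have "card (carrier G) * card T = card (carrier G) * m"
    using bij_betw_same_card[OF bij] assms(4) by (simp add: card_cartesian_product)
  moreover have "card (carrier G) \<noteq> 0"
    using assms(2) G.one_closed by (auto simp: card_eq_0_iff)
  ultimately have "card T = card {1..m}" by simp
  moreover have "finite T" using T assms(3) finite_subset by blast
  ultimately obtain t where t: "bij_betw t {1..m} T"
    by (metis finite_atLeastAtMost finite_same_card_bij)
  define p where "p = (\<lambda>(x, s). \<phi> (inv\<^bsub>G\<^esub> x) s) \<circ> map_prod id t"
  have "bij_betw (map_prod id t) (carrier G \<times> {1..m}) (carrier G \<times> T)"
    using t by (intro bij_betw_map_prod) (auto simp: bij_betw_def)
  then have "bij_betw p (mcay_verts G m) V"
    unfolding p_def mcay_verts_def using bij by (rule bij_betw_trans)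
  moreover have "p (x \<otimes>\<^bsub>G\<^esub> g, i) = \<phi> (inv\<^bsub>G\<^esub> g) (p (x, i))"
    if "x \<in> carrier G" "g \<in> carrier G" "i \<in> {1..m}" for x g i
  proof -
    have "t i \<in> V" using t T that by (auto simp: bij_betw_def)
    then show ?thesis
      using that by (simp add: p_def G.inv_mult_group composition_rule)
  qed
  ultimately show thesis using that by blast
qed

section \<open>Semiregular subgroups are the conjugates of the right regular group\<close>

lemma semiregular_iff:
  assumes "subgroup H (BijGroup V)"
  shows "semiregular V H \<longleftrightarrow> (\<forall>h\<in>H. \<forall>v\<in>V. h v = v \<longrightarrow> h = \<one>\<^bsub>BijGroup V\<^esub>)"
  using subgroup.one_closed[OF assms]
  by (auto simp: semiregular_def stabilizer_def one_BijGroup)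

text \<open>An isomorphism from \<open>G\<close> to \<open>H\<close> is the same thing as an action of \<open>G\<close> whose image is \<open>H\<close> and
  which is faithful; semiregularity of \<open>H\<close> makes it free. If \<open>V\<close> were empty, the trivial group
  would be the image of a free action of every \<open>G\<close>.\<close>

lemma semiregular_iff_free_action:
  assumes "group G" and "V \<noteq> {}"
  shows "subgroup H (BijGroup V) \<and> semiregular V H \<and> BijGroup V\<lparr>carrier := H\<rparr> \<cong> G \<longleftrightarrow>
         (\<exists>\<phi>. free_action G V \<phi> \<and> H = \<phi> ` carrier G)"
    (is "?L \<longleftrightarrow> ?R")
proof
  interpret G: group G by fact
  interpret B: group "BijGroup V" by (rule group_BijGroup)
  {
    assume L: ?L
    then have H: "subgroup H (BijGroup V)" by blast
    from L have "BijGroup V\<lparr>carrier := H\<rparr> \<cong> G" by blast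
    then have "G \<cong> BijGroup V\<lparr>carrier := H\<rparr>"
      by (rule group.iso_sym[OF B.subgroup_imp_group[OF H]])
    then obtain \<phi> where \<phi>: "\<phi> \<in> iso G (BijGroup V\<lparr>carrier := H\<rparr>)"
      by (auto simp: is_iso_def)
    have im: "\<phi> ` carrier G = H" and inj: "inj_on \<phi> (carrier G)"
      using \<phi> by (auto simp: iso_def bij_betw_def)
    have hom: "\<phi> \<in> hom G (BijGroup V)"
    proof (rule homI)
      have hom': "\<phi> \<in> hom G (BijGroup V\<lparr>carrier := H\<rparr>)"
        using \<phi> by (simp add: iso_def)
      show "\<phi> g \<in> carrier (BijGroup V)" if "g \<in> carrier G" for g
        using subgroup.mem_carrier[OF H] imageI[OF that, of \<phi>] unfolding im .
      show "\<phi> (g \<otimes>\<^bsub>G\<^esub> h) = \<phi> g \<otimes>\<^bsub>BijGroup V\<^esub> \<phi> h"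
        if "g \<in> carrier G" "h \<in> carrier G" for g h
        using Group.hom_mult[OF hom' that] by simp
    qed
    have act: "group_action G V \<phi>"
    proof (rule group_action.intro, rule group_hom.intro)
      show "group_hom_axioms G (BijGroup V) \<phi>" using hom by (rule group_hom_axioms.intro)
    qed (rule assms(1) B.group_axioms)+
    have "g = \<one>\<^bsub>G\<^esub>" if "g \<in> carrier G" "v \<in> V" "\<phi> g v = v" for g v
    proof -
      have "\<phi> g = \<one>\<^bsub>BijGroup V\<^esub>"
        using L semiregular_iff[OF H] imageI[OF that(1), of \<phi>] that(2,3) unfolding im by blast
      then have "\<phi> g = \<phi> \<one>\<^bsub>G\<^esub>"
        using hom_one[OF hom assms(1) B.group_axioms] by simp
      then show ?thesis using inj that by (auto dest: inj_onD)
    qed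
    then show ?R using act im unfolding free_action_def by blast
  next
    assume ?R
    then obtain \<phi> where \<phi>: "free_action G V \<phi>" and H: "H = \<phi> ` carrier G" by blast
    have act: "group_action G V \<phi>" using \<phi> by (simp add: free_action_def)
    have free: "g = \<one>\<^bsub>G\<^esub>" if "g \<in> carrier G" "v \<in> V" "\<phi> g v = v" for g v
      using \<phi> that unfolding free_action_def by blast
    interpret group_hom G "BijGroup V" \<phi>
      using act by (simp add: group_action_def)
    have sub: "subgroup H (BijGroup V)"
      unfolding H by (rule img_is_subgroup)
    have "semiregular V H"
      unfolding semiregular_iff[OF sub]
    proof (intro ballI impI)
      fix h v assume "h \<in> H" "v \<in> V" "h v = v"
      then obtain g where g: "g \<in> carrier G" "h = \<phi> g" unfolding H by blast
      then have "g = \<one>\<^bsub>G\<^esub>" using free[OF g(1) \<open>v \<in> V\<close>] \<open>h v = v\<close> by simp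
      then show "h = \<one>\<^bsub>BijGroup V\<^esub>" using g hom_one by simp
    qed
    moreover have "inj_on \<phi> (carrier G)"
      unfolding inj_on_one_iff
    proof (intro allI impI)
      fix g assume g: "g \<in> carrier G" "\<phi> g = \<one>\<^bsub>BijGroup V\<^esub>"
      obtain v where v: "v \<in> V" using assms(2) by blast
      show "g = \<one>\<^bsub>G\<^esub>" using free[OF g(1) v] g(2) v by (simp add: one_BijGroup)
    qed
    then have "\<phi> \<in> iso G (BijGroup V\<lparr>carrier := H\<rparr>)"
    proof -
      assume inj: "inj_on \<phi> (carrier G)"
      have "\<phi> \<in> hom G (BijGroup V\<lparr>carrier := H\<rparr>)"
      proof (rule homI)
        show "\<phi> g \<in> carrier (BijGroup V\<lparr>carrier := H\<rparr>)" if "g \<in> carrier G" for g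
          using that by (simp add: H)
        show "\<phi> (g \<otimes>\<^bsub>G\<^esub> h) = \<phi> g \<otimes>\<^bsub>BijGroup V\<lparr>carrier := H\<rparr>\<^esub> \<phi> h"
          if "g \<in> carrier G" "h \<in> carrier G" for g h
          using hom_mult[OF that] by simp
      qed
      then show ?thesis using inj by (simp add: iso_def bij_betw_def H)
    qed
    then have "BijGroup V\<lparr>carrier := H\<rparr> \<cong> G"
      by (rule G.iso_sym[OF is_isoI])
    ultimately show ?L using sub by blast
  }
qed

lemma right_mult_apply:
  assumes "x \<in> carrier G" and "i \<in> {1..m}"
  shows "right_mult G m g (x, i) = (x \<otimes>\<^bsub>G\<^esub> g, i)"
  using assms by (simp add: right_mult_def mcay_verts_def)

lemma right_mult_Bij:
  assumes "group G" and "g \<in> carrier G"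
  shows "right_mult G m g \<in> Bij (mcay_verts G m)"
proof -
  interpret G: group G by fact
  have "bij_betw (\<lambda>(x, i). (x \<otimes>\<^bsub>G\<^esub> g, i)) (mcay_verts G m) (mcay_verts G m)"
    using assms(2)
    by (intro bij_betwI[where g = "\<lambda>(x, i). (x \<otimes>\<^bsub>G\<^esub> inv\<^bsub>G\<^esub> g, i)"])
       (auto simp: mcay_verts_def G.m_assoc)
  then show ?thesis
    by (simp add: Bij_def right_mult_def bij_betw_restrict_eq)
qed

lemma right_regular_subset:
  assumes "group G"
  shows "right_regular G m \<subseteq> carrier (BijGroup (mcay_verts G m))"
  using right_mult_Bij[OF assms] by (auto simp: right_regular_def)

text \<open>The inverse makes a homomorphism of the right multiplications, which reverse products when
  they are composed as functions.\<close>

lemma free_action_right_mult_inv: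
  assumes "group G"
  shows "free_action G (mcay_verts G m) (\<lambda>g. right_mult G m (inv\<^bsub>G\<^esub> g))"
proof -
  interpret G: group G by fact
  interpret B: group "BijGroup (mcay_verts G m)" by (rule group_BijGroup)
  have "right_mult G m (inv\<^bsub>G\<^esub> (g \<otimes>\<^bsub>G\<^esub> h)) =
          right_mult G m (inv\<^bsub>G\<^esub> g) \<otimes>\<^bsub>BijGroup (mcay_verts G m)\<^esub> right_mult G m (inv\<^bsub>G\<^esub> h)"
    if "g \<in> carrier G" "h \<in> carrier G" for g h
  proof (rule Bij_eqI)
    show "right_mult G m (inv\<^bsub>G\<^esub> g) \<otimes>\<^bsub>BijGroup (mcay_verts G m)\<^esub> right_mult G m (inv\<^bsub>G\<^esub> h)
            \<in> Bij (mcay_verts G m)"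
      using B.m_closed that by (simp add: right_mult_Bij[OF assms])
    fix v assume v: "v \<in> mcay_verts G m"
    then obtain x i where "v = (x, i)" "x \<in> carrier G" "i \<in> {1..m}"
      by (auto simp: mcay_verts_def)
    then show "right_mult G m (inv\<^bsub>G\<^esub> (g \<otimes>\<^bsub>G\<^esub> h)) v =
        (right_mult G m (inv\<^bsub>G\<^esub> g) \<otimes>\<^bsub>BijGroup (mcay_verts G m)\<^esub> right_mult G m (inv\<^bsub>G\<^esub> h)) v"
      using v that by (simp add: mult_BijGroup_apply right_mult_Bij[OF assms] right_mult_apply
          G.inv_mult_group G.m_assoc)
  qed (use that in \<open>simp add: right_mult_Bij[OF assms]\<close>)
  then have "group_action G (mcay_verts G m) (\<lambda>g. right_mult G m (inv\<^bsub>G\<^esub> g))"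
    by (auto simp: group_action_def group_hom_def group_hom_axioms_def hom_def
        assms B.group_axioms right_mult_Bij[OF assms])
  then show ?thesis
    by (auto simp: free_action_def mcay_verts_def right_mult_apply)
qed

lemma right_regular_eq_image_inv:
  assumes "group G"
  shows "right_regular G m = (\<lambda>g. right_mult G m (inv\<^bsub>G\<^esub> g)) ` carrier G"
proof -
  interpret G: group G by fact
  have "(\<lambda>g. inv\<^bsub>G\<^esub> g) ` carrier G = carrier G"
    using G.inv_inv G.inv_closed by (metis image_eqI subsetI subset_antisym image_subsetI)
  then show ?thesis
    unfolding right_regular_def by (metis image_image)
qed

lemma free_action_conjugate:
  assumes "free_action G V \<phi>" and "q \<in> Bij V"
  shows "free_action G V (\<lambda>g. q \<otimes>\<^bsub>BijGroup V\<^esub> \<phi> g \<otimes>\<^bsub>BijGroup V\<^esub> inv\<^bsub>BijGroup V\<^esub> q)"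
    (is "free_action G V ?\<psi>")
proof -
  interpret B: group "BijGroup V" by (rule group_BijGroup)
  interpret group_action G V \<phi>
    using assms by (simp add: free_action_def)
  interpret group_hom G "BijGroup V" \<phi> by (rule group_hom)
  have q: "q \<in> carrier (BijGroup V)" using assms by simp
  have "?\<psi> \<in> hom G (BijGroup V)"
  proof (rule homI)
    fix g h assume "g \<in> carrier G" "h \<in> carrier G"
    then show "?\<psi> (g \<otimes>\<^bsub>G\<^esub> h) = ?\<psi> g \<otimes>\<^bsub>BijGroup V\<^esub> ?\<psi> h"
      using q by (simp add: B.m_assoc B.inv_solve_left del: carrier_BijGroup)
  qed (use q in \<open>simp del: carrier_BijGroup\<close>)
  moreover have "g = \<one>\<^bsub>G\<^esub>" if g: "g \<in> carrier G" and v: "v \<in> V" and fixed: "?\<psi> g v = v" for g v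
  proof -
    have Bij: "inv\<^bsub>BijGroup V\<^esub> q \<in> Bij V" "\<phi> g \<in> Bij V" "q \<otimes>\<^bsub>BijGroup V\<^esub> \<phi> g \<in> Bij V"
      using B.inv_closed[OF q] hom_closed[OF g] B.m_closed[OF q hom_closed[OF g]] by auto
    let ?w = "(inv\<^bsub>BijGroup V\<^esub> q) v"
    have w: "?w \<in> V" using Bij v by (blast intro: Bij_apply_mem)
    have "q ?w = v"
      using B.r_inv[OF q] mult_BijGroup_apply[of q V "inv\<^bsub>BijGroup V\<^esub> q" v] v Bij assms(2)
      by (simp add: one_BijGroup)
    then have "q (\<phi> g ?w) = q ?w"
      using fixed Bij assms(2) v w by (simp add: mult_BijGroup_apply)
    then have "\<phi> g ?w = ?w"
      using Bij_apply_eq_iff[OF assms(2)] w Bij_apply_mem[OF Bij(2)] by blast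
    then show ?thesis using assms(1) g w by (auto simp: free_action_def)
  qed
  ultimately show ?thesis
    by (simp add: free_action_def group_action_def group_hom_def group_hom_axioms_def
        G.group_axioms B.group_axioms)
qed

text \<open>The coordinates of a free action are a permutation \<open>p\<close> of \<open>V\<close> that intertwines it with
  the action by right multiplication, so that the images of the two actions are conjugate by \<open>p\<close>.
  Conversely, conjugation by a permutation preserves free actions.\<close>

theorem semiregular_iff_conjugate_right_regular:
  assumes "group G" and "finite (carrier G)" and "m \<ge> 1"
  defines "B \<equiv> BijGroup (mcay_verts G m)"
  shows "subgroup H B \<and> semiregular (mcay_verts G m) H \<and> B\<lparr>carrier := H\<rparr> \<cong> G \<longleftrightarrow>
         (\<exists>p\<in>carrier B. H = conj_set B p (right_regular G m))"
    (is "_ \<longleftrightarrow> ?R")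
proof -
  let ?V = "mcay_verts G m"
  let ?\<rho> = "\<lambda>g. right_mult G m (inv\<^bsub>G\<^esub> g)"
  interpret G: group G by fact
  interpret B: group B unfolding B_def by (rule group_BijGroup)
  have ne: "?V \<noteq> {}"
    using G.one_closed assms(3) by (auto simp: mcay_verts_def)
  have fin: "finite ?V" and card: "card ?V = card (carrier G) * m"
    using assms(2) by (auto simp: mcay_verts_def card_cartesian_product)
  have "(\<exists>\<phi>. free_action G ?V \<phi> \<and> H = \<phi> ` carrier G) \<longleftrightarrow> ?R"
  proof
    assume "\<exists>\<phi>. free_action G ?V \<phi> \<and> H = \<phi> ` carrier G"
    then obtain \<phi> where free: "free_action G ?V \<phi>" and H: "H = \<phi> ` carrier G" by blast
    obtain p' where bij: "bij_betw p' ?V ?V"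
      and eq: "\<And>x g i. x \<in> carrier G \<Longrightarrow> g \<in> carrier G \<Longrightarrow> i \<in> {1..m} \<Longrightarrow>
                 p' (x \<otimes>\<^bsub>G\<^esub> g, i) = \<phi> (inv\<^bsub>G\<^esub> g) (p' (x, i))"
      using free_action_coordinates[OF free assms(2) fin card] by blast
    define p where "p = restrict p' ?V"
    have p: "p \<in> Bij ?V"
      using bij by (simp add: p_def Bij_def bij_betw_restrict_eq)
    interpret group_action G ?V \<phi> using free by (simp add: free_action_def)
    have "p \<otimes>\<^bsub>B\<^esub> ?\<rho> g \<otimes>\<^bsub>B\<^esub> inv\<^bsub>B\<^esub> p = \<phi> g" if g: "g \<in> carrier G" for g
    proof -
      have \<rho>: "?\<rho> g \<in> Bij ?V" using right_mult_Bij[OF assms(1)] g by simp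
      have \<phi>: "\<phi> g \<in> Bij ?V" using bij_prop0 g by blast
      \<comment> \<open>This is \<open>eq\<close> with \<open>g\<inverse>\<close> in place of \<open>g\<close>.\<close>
      have "p \<otimes>\<^bsub>B\<^esub> ?\<rho> g = \<phi> g \<otimes>\<^bsub>B\<^esub> p"
      proof (rule Bij_eqI)
        show "p \<otimes>\<^bsub>B\<^esub> ?\<rho> g \<in> Bij ?V" "\<phi> g \<otimes>\<^bsub>B\<^esub> p \<in> Bij ?V"
          using B.m_closed p \<rho> \<phi> by (auto simp: B_def)
        fix v assume v: "v \<in> ?V"
        then obtain x i where "v = (x, i)" "x \<in> carrier G" "i \<in> {1..m}"
          by (auto simp: mcay_verts_def)
        then show "(p \<otimes>\<^bsub>B\<^esub> ?\<rho> g) v = (\<phi> g \<otimes>\<^bsub>B\<^esub> p) v"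
          using v g p \<rho> \<phi> eq[of x "inv\<^bsub>G\<^esub> g" i]
          by (simp add: B_def mult_BijGroup_apply right_mult_apply p_def)
             (simp add: mcay_verts_def)
      qed
      then show ?thesis
        using B.inv_solve_right'[of "\<phi> g" "p \<otimes>\<^bsub>B\<^esub> ?\<rho> g" p] p \<rho> \<phi> B.m_closed[of p "?\<rho> g"]
        by (simp add: B_def)
    qed
    then have "conj_set B p (right_regular G m) = H"
      unfolding conj_set_eq_image right_regular_eq_image_inv[OF assms(1)] image_image H
      by (intro image_cong) auto
    then show ?R using p by (auto simp: B_def)
  next
    assume ?R
    then obtain q where q: "q \<in> Bij ?V"
      and H: "H = conj_set B q (right_regular G m)"
      by (auto simp: B_def)
    have "free_action G ?V (\<lambda>g. q \<otimes>\<^bsub>B\<^esub> ?\<rho> g \<otimes>\<^bsub>B\<^esub> inv\<^bsub>B\<^esub> q)"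
      unfolding B_def using free_action_right_mult_inv[OF assms(1)] q
      by (rule free_action_conjugate)
    moreover have "H = (\<lambda>g. q \<otimes>\<^bsub>B\<^esub> ?\<rho> g \<otimes>\<^bsub>B\<^esub> inv\<^bsub>B\<^esub> q) ` carrier G"
      unfolding H conj_set_eq_image right_regular_eq_image_inv[OF assms(1)] image_image ..
    ultimately show "\<exists>\<phi>. free_action G ?V \<phi> \<and> H = \<phi> ` carrier G" by blast
  qed
  then show ?thesis
    unfolding B_def using semiregular_iff_free_action[OF assms(1) ne] by simp
qed

section \<open>Relabelling a digraph by a permutation of its vertices\<close>

text \<open>Taking images is a left action of the permutations of the vertex set on the digraphs, and the automorphism group is a stabilizer of this action. Conjugation by \<open>p\<close> thus carries
  the automorphism group of a digraph to that of its image.\<close>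

lemma digraph_perm_image_simps [simp]:
  "pverts (digraph_perm_image p \<Gamma>) = pverts \<Gamma>"
  "parcs (digraph_perm_image p \<Gamma>) = map_prod p p ` parcs \<Gamma>"
  by (force simp: digraph_perm_image_def)+

lemma pair_pre_digraph_eqI:
  fixes \<Gamma> \<Sigma> :: "'v pair_pre_digraph"
  assumes "pverts \<Gamma> = pverts \<Sigma>" and "parcs \<Gamma> = parcs \<Sigma>"
  shows "\<Gamma> = \<Sigma>"
  using assms by simp

context pair_wf_digraph
begin

lemma pair_wf_digraph_perm_image:
  assumes "p \<in> Bij (pverts G)"
  shows "pair_wf_digraph (digraph_perm_image p G)"
proof unfold_locales
  fix a assume "a \<in> parcs (digraph_perm_image p G)"
  then obtain u v where "(u, v) \<in> parcs G" "a = (p u, p v)" by auto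
  then show "fst a \<in> pverts (digraph_perm_image p G)" "snd a \<in> pverts (digraph_perm_image p G)"
    using in_arcsD1 in_arcsD2 Bij_apply_mem[OF assms] by auto
qed

lemma perm_image_one: "digraph_perm_image \<one>\<^bsub>BijGroup (pverts G)\<^esub> G = G"
proof (rule pair_pre_digraph_eqI)
  have "map_prod \<one>\<^bsub>BijGroup (pverts G)\<^esub> \<one>\<^bsub>BijGroup (pverts G)\<^esub> ` parcs G = (\<lambda>a. a) ` parcs G"
    by (intro image_cong) (auto simp: one_BijGroup dest: in_arcsD1 in_arcsD2)
  then show "parcs (digraph_perm_image \<one>\<^bsub>BijGroup (pverts G)\<^esub> G) = parcs G" by simp
qed simp

lemma perm_image_mult:
  assumes "p \<in> Bij (pverts G)" and "q \<in> Bij (pverts G)"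
  shows "digraph_perm_image (p \<otimes>\<^bsub>BijGroup (pverts G)\<^esub> q) G =
           digraph_perm_image p (digraph_perm_image q G)"
proof (rule pair_pre_digraph_eqI)
  show "parcs (digraph_perm_image (p \<otimes>\<^bsub>BijGroup (pverts G)\<^esub> q) G) =
          parcs (digraph_perm_image p (digraph_perm_image q G))"
    unfolding digraph_perm_image_simps image_image
  proof (rule image_cong[OF refl])
    fix a assume "a \<in> parcs G"
    then show "map_prod (p \<otimes>\<^bsub>BijGroup (pverts G)\<^esub> q) (p \<otimes>\<^bsub>BijGroup (pverts G)\<^esub> q) a =
                 map_prod p p (map_prod q q a)"
      using assms arc_fst_in_verts arc_snd_in_verts
      by (simp add: map_prod_def split_beta mult_BijGroup_apply)
  qed
qed simp

lemma mem_DigraphAut_iff: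
  "p \<in> carrier (DigraphAut G) \<longleftrightarrow> p \<in> Bij (pverts G) \<and> digraph_perm_image p G = G"
proof -
  have "(\<forall>u\<in>pverts G. \<forall>v\<in>pverts G. (p u, p v) \<in> parcs G \<longleftrightarrow> (u, v) \<in> parcs G) \<longleftrightarrow>
          map_prod p p ` parcs G = parcs G" if p: "p \<in> Bij (pverts G)"
  proof (rule iffI)
    assume iff: "\<forall>u\<in>pverts G. \<forall>v\<in>pverts G. (p u, p v) \<in> parcs G \<longleftrightarrow> (u, v) \<in> parcs G"
    show "map_prod p p ` parcs G = parcs G"
    proof (intro equalityI subsetI)
      fix a assume "a \<in> map_prod p p ` parcs G"
      then obtain u v where "(u, v) \<in> parcs G" "a = (p u, p v)" by auto
      then show "a \<in> parcs G" using iff in_arcsD1 in_arcsD2 by blast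
    next
      fix a assume a: "a \<in> parcs G"
      then have "fst a \<in> p ` pverts G" "snd a \<in> p ` pverts G"
        using Bij_image[OF p] arc_fst_in_verts arc_snd_in_verts by auto
      then obtain u v where "u \<in> pverts G" "v \<in> pverts G" "a = (p u, p v)"
        by (metis imageE prod.collapse)
      then show "a \<in> map_prod p p ` parcs G"
        using iff a by (metis image_eqI map_prod_simp)
    qed
  next
    assume eq: "map_prod p p ` parcs G = parcs G"
    show "\<forall>u\<in>pverts G. \<forall>v\<in>pverts G. (p u, p v) \<in> parcs G \<longleftrightarrow> (u, v) \<in> parcs G"
    proof (intro ballI, rule iffI)
      fix u v assume u: "u \<in> pverts G" and v: "v \<in> pverts G"
      assume "(p u, p v) \<in> parcs G"
      then have "(p u, p v) \<in> map_prod p p ` parcs G" by (simp add: eq)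
      then obtain u' v' where uv': "(u', v') \<in> parcs G" "p u = p u'" "p v = p v'" by auto
      then have "u = u'" "v = v'"
        using Bij_apply_eq_iff[OF p u] Bij_apply_eq_iff[OF p v] in_arcsD1 in_arcsD2 by auto
      then show "(u, v) \<in> parcs G" using uv' by simp
    next
      fix u v assume "(u, v) \<in> parcs G"
      then have "map_prod p p (u, v) \<in> map_prod p p ` parcs G" by (rule imageI)
      then show "(p u, p v) \<in> parcs G" by (simp add: eq)
    qed
  qed
  moreover have "digraph_perm_image p G = G \<longleftrightarrow> map_prod p p ` parcs G = parcs G"
    by (metis digraph_perm_image_simps pair_pre_digraph_eqI)
  ultimately show ?thesis by (auto simp: DigraphAut_def)
qed

lemma perm_image_inv_eq_iff:
  assumes "p \<in> Bij (pverts G)" and "pair_wf_digraph \<Sigma>" and "pverts \<Sigma> = pverts G"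
  shows "digraph_perm_image (inv\<^bsub>BijGroup (pverts G)\<^esub> p) \<Sigma> = G \<longleftrightarrow> digraph_perm_image p G = \<Sigma>"
proof -
  interpret B: group "BijGroup (pverts G)" by (rule group_BijGroup)
  interpret S: pair_wf_digraph \<Sigma> by fact
  have p: "p \<in> carrier (BijGroup (pverts G))" using assms by simp
  have p': "inv\<^bsub>BijGroup (pverts G)\<^esub> p \<in> Bij (pverts G)" using B.inv_closed[OF p] by simp
  show ?thesis
    using perm_image_mult[OF p' assms(1)] S.perm_image_mult[of p "inv\<^bsub>BijGroup (pverts G)\<^esub> p"]
      B.l_inv[OF p] B.r_inv[OF p] perm_image_one S.perm_image_one assms p'
    by metis
qed

lemma subgroup_DigraphAut: "subgroup (carrier (DigraphAut G)) (BijGroup (pverts G))"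
proof -
  interpret B: group "BijGroup (pverts G)" by (rule group_BijGroup)
  have m: "p \<otimes>\<^bsub>BijGroup (pverts G)\<^esub> q \<in> Bij (pverts G)"
    if "p \<in> Bij (pverts G)" "q \<in> Bij (pverts G)" for p q
    using B.m_closed that by simp
  have i: "inv\<^bsub>BijGroup (pverts G)\<^esub> p \<in> Bij (pverts G)" if "p \<in> Bij (pverts G)" for p
    using B.inv_closed that by simp
  show ?thesis
  proof (rule B.subgroupI)
    show "carrier (DigraphAut G) \<noteq> {}"
      using perm_image_one B.one_closed mem_DigraphAut_iff by auto
  qed (auto simp: mem_DigraphAut_iff perm_image_mult m i perm_image_inv_eq_iff pair_wf_digraph_axioms)
qed

text \<open>If \<open>h\<close> fixes the digraph, then \<open>p h p\<inverse>\<close> fixes its image under \<open>p\<close>.\<close>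

lemma conj_set_subset_DigraphAut:
  assumes "p \<in> Bij (pverts G)" and "H \<subseteq> carrier (DigraphAut G)"
  shows "conj_set (BijGroup (pverts G)) p H
           \<subseteq> carrier (DigraphAut (digraph_perm_image p G))"
proof -
  let ?B = "BijGroup (pverts G)"
  let ?\<Sigma> = "digraph_perm_image p G"
  interpret B: group ?B by (rule group_BijGroup)
  interpret S: pair_wf_digraph ?\<Sigma> by (rule pair_wf_digraph_perm_image) fact
  have p: "p \<in> carrier ?B" using assms by simp
  have "p \<otimes>\<^bsub>?B\<^esub> h \<otimes>\<^bsub>?B\<^esub> inv\<^bsub>?B\<^esub> p \<in> carrier (DigraphAut ?\<Sigma>)" if "h \<in> H" for h
  proof -
    have h: "h \<in> Bij (pverts G)" "digraph_perm_image h G = G"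
      using that assms(2) mem_DigraphAut_iff by auto
    have Bij: "inv\<^bsub>?B\<^esub> p \<in> Bij (pverts G)" "p \<otimes>\<^bsub>?B\<^esub> h \<in> Bij (pverts G)"
      "p \<otimes>\<^bsub>?B\<^esub> h \<otimes>\<^bsub>?B\<^esub> inv\<^bsub>?B\<^esub> p \<in> Bij (pverts G)"
      using B.inv_closed[OF p] B.m_closed p h by auto
    have "digraph_perm_image (inv\<^bsub>?B\<^esub> p) ?\<Sigma> = G"
      using perm_image_inv_eq_iff[OF assms(1) S.pair_wf_digraph_axioms] by simp
    then have "digraph_perm_image (p \<otimes>\<^bsub>?B\<^esub> h \<otimes>\<^bsub>?B\<^esub> inv\<^bsub>?B\<^esub> p) ?\<Sigma> = ?\<Sigma>"
      using S.perm_image_mult[of "p \<otimes>\<^bsub>?B\<^esub> h" "inv\<^bsub>?B\<^esub> p"] perm_image_mult[of p h] Bij h assms(1)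
      by simp
    then show ?thesis using S.mem_DigraphAut_iff Bij by simp
  qed
  then show ?thesis by (auto simp: conj_set_eq_image)
qed

text \<open>Arcs are determined by their ends, so the arc component of an isomorphism is forced by the
  vertex component. Restricting the latter to the vertex set makes it a member of \<^const>\<open>Bij\<close>, which
  consists of extensional functions.\<close>

lemma digraph_iso_iff_perm_image:
  assumes "pverts \<Sigma> = pverts G"
  shows "digraph_iso (with_proj G) (with_proj \<Sigma>) \<longleftrightarrow>
         (\<exists>p\<in>Bij (pverts G). digraph_perm_image p G = \<Sigma>)" (is "?L \<longleftrightarrow> ?R")
proof
  assume ?L
  then obtain f where f: "pre_digraph.digraph_isomorphism (with_proj G) f"
    and eq: "with_proj \<Sigma> = app_iso f (with_proj G)"
    by (auto simp: digraph_iso_def)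
  have "verts (with_proj \<Sigma>) = iso_verts f ` pverts G" "arcs (with_proj \<Sigma>) = iso_arcs f ` parcs G"
    "tail (with_proj \<Sigma>) = iso_tail f" "head (with_proj \<Sigma>) = iso_head f"
    unfolding eq by auto
  then have V: "pverts G = iso_verts f ` pverts G" and A: "parcs \<Sigma> = iso_arcs f ` parcs G"
    and [simp]: "iso_tail f = fst" "iso_head f = snd"
    using assms by auto
  have inj: "inj_on (iso_verts f) (pverts G)"
    and ends: "\<And>a. a \<in> parcs G \<Longrightarrow> iso_arcs f a = map_prod (iso_verts f) (iso_verts f) a"
    using f by (auto simp: pre_digraph.digraph_isomorphism_def prod_eq_iff)
  define p where "p = restrict (iso_verts f) (pverts G)"
  have "p \<in> Bij (pverts G)"
    using inj V by (simp add: p_def Bij_def bij_betw_restrict_eq bij_betw_def)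
  moreover have "digraph_perm_image p G = \<Sigma>"
  proof (rule pair_pre_digraph_eqI)
    show "parcs (digraph_perm_image p G) = parcs \<Sigma>"
      unfolding A digraph_perm_image_simps
      by (intro image_cong) (auto simp: ends p_def dest: in_arcsD1 in_arcsD2)
  qed (use assms in simp)
  ultimately show ?R by blast
next
  assume ?R
  then obtain p where p: "p \<in> Bij (pverts G)" and \<Sigma>: "digraph_perm_image p G = \<Sigma>" by blast
  define f where "f = \<lparr>iso_verts = p, iso_arcs = map_prod p p, iso_head = snd, iso_tail = fst\<rparr>"
  have inj: "inj_on p (pverts G)" using p by (simp add: Bij_def bij_betw_def)
  have "inj_on (map_prod p p) (parcs G)"
    using map_prod_inj_on[OF inj inj] by (rule inj_on_subset) (auto dest: in_arcsD1 in_arcsD2)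
  then have "pre_digraph.digraph_isomorphism (with_proj G) f"
    using inj wf_digraph_wp_iff pair_wf_digraph_axioms
    by (auto simp: pre_digraph.digraph_isomorphism_def f_def)
  moreover have "with_proj \<Sigma> = app_iso f (with_proj G)"
    using Bij_image[OF p] by (simp add: \<Sigma>[symmetric] with_proj_def app_iso_def f_def)
  ultimately show ?L by (auto simp: digraph_iso_def)
qed

end

lemma (in pair_loopfree_digraph) pair_loopfree_digraph_perm_image:
  assumes "p \<in> Bij (pverts G)"
  shows "pair_loopfree_digraph (digraph_perm_image p G)"
proof -
  interpret S: pair_wf_digraph "digraph_perm_image p G"
    using assms by (rule pair_wf_digraph_perm_image)
  show ?thesis
  proof unfold_locales
    fix a assume "a \<in> parcs (digraph_perm_image p G)"
    then obtain u v where uv: "(u, v) \<in> parcs G" "a = (p u, p v)" by auto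
    then show "fst a \<noteq> snd a"
      using Bij_apply_eq_iff[OF assms in_arcsD1[OF uv(1)] in_arcsD2[OF uv(1)]] pair_no_loops[OF uv(1)]
      by simp
  qed
qed

lemma pair_graph_perm_image:
  assumes "pair_graph \<Gamma>" and "p \<in> Bij (pverts \<Gamma>)"
  shows "pair_graph (digraph_perm_image p \<Gamma>)"
proof -
  interpret pair_graph \<Gamma> by fact
  interpret S: pair_loopfree_digraph "digraph_perm_image p \<Gamma>"
    using assms(2) by (rule pair_loopfree_digraph_perm_image)
  show ?thesis
  proof unfold_locales
    show "finite (pverts (digraph_perm_image p \<Gamma>))" "finite (parcs (digraph_perm_image p \<Gamma>))"
      using pair_finite_verts pair_finite_arcs by auto
    show "symmetric (with_proj (digraph_perm_image p \<Gamma>))"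
    proof -
      have "sym (parcs \<Gamma>)" using pair_sym_arcs by (simp add: symmetric_def)
      then have "(p v, p u) \<in> map_prod p p ` parcs \<Gamma>" if "(u, v) \<in> parcs \<Gamma>" for u v
        using that by (metis image_eqI map_prod_simp symD)
      then show ?thesis by (auto simp: symmetric_def sym_def)
    qed
  qed
qed

section \<open>Cayley digraphs and their automorphisms\<close>

lemma arc_mCay_iff:
  assumes "group G" and "connection_family G m S"
  shows "((x, i), (y, j)) \<in> parcs (mCay G m S) \<longleftrightarrow>
         i \<in> {1..m} \<and> j \<in> {1..m} \<and> x \<in> carrier G \<and> y \<in> carrier G \<and> y \<otimes>\<^bsub>G\<^esub> inv\<^bsub>G\<^esub> x \<in> S i j"
    (is "?L \<longleftrightarrow> ?R")
proof
  interpret G: group G by fact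
  {
    assume ?L
    then obtain s where s: "i \<in> {1..m}" "j \<in> {1..m}" "s \<in> S i j" "x \<in> carrier G" "y = s \<otimes>\<^bsub>G\<^esub> x"
      by (auto simp: mCay_def)
    moreover from this have "s \<in> carrier G" using assms(2) unfolding connection_family_def by blast
    ultimately show ?R by (simp add: G.m_assoc)
  next
    assume R: ?R
    then have "y = (y \<otimes>\<^bsub>G\<^esub> inv\<^bsub>G\<^esub> x) \<otimes>\<^bsub>G\<^esub> x" by (simp add: G.m_assoc)
    then show ?L using R by (auto simp: mCay_def)
  }
qed

text \<open>For given \<open>i\<close> and \<open>j\<close>, whether \<open>(x, i)\<close> and \<open>(y, j)\<close> form an arc of a Cayley digraph depends
  only on \<open>y x\<inverse>\<close>, which right multiplication does not change. Conversely, if right multiplications are automorphisms, then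
  the one by \<open>x\<inverse>\<close> moves the tail of the arc to \<open>(\<one>, i)\<close>, so that the arcs that leave these \<open>m\<close> vertices determine all
  others. Having no loops corresponds to the condition that \<open>\<one>\<close> is not in \<open>S i i\<close>.\<close>

lemma is_mcayley_digraph_iff:
  assumes "group G"
  shows "is_mcayley_digraph G m \<Sigma> \<longleftrightarrow>
         pair_loopfree_digraph \<Sigma> \<and> pverts \<Sigma> = mcay_verts G m \<and>
         right_regular G m \<subseteq> carrier (DigraphAut \<Sigma>)" (is "?L \<longleftrightarrow> ?R")
proof
  interpret G: group G by fact
  {
    assume ?L
    then obtain S where S: "connection_family G m S" and \<Sigma>: "\<Sigma> = mCay G m S"
      by (auto simp: is_mcayley_digraph_def)
    have V: "pverts \<Sigma> = mcay_verts G m" by (simp add: \<Sigma> mCay_def)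
    have arc: "((x, i), (y, j)) \<in> parcs \<Sigma> \<longleftrightarrow>
         i \<in> {1..m} \<and> j \<in> {1..m} \<and> x \<in> carrier G \<and> y \<in> carrier G \<and> y \<otimes>\<^bsub>G\<^esub> inv\<^bsub>G\<^esub> x \<in> S i j"
      for x i y j
      unfolding \<Sigma> by (rule arc_mCay_iff[OF assms S])
    have "pair_loopfree_digraph \<Sigma>"
      using S by unfold_locales
        (auto simp: arc V mcay_verts_def connection_family_def)
    moreover have "right_mult G m g \<in> carrier (DigraphAut \<Sigma>)" if "g \<in> carrier G" for g
    proof -
      have "y \<otimes>\<^bsub>G\<^esub> g \<otimes>\<^bsub>G\<^esub> inv\<^bsub>G\<^esub> (x \<otimes>\<^bsub>G\<^esub> g) = y \<otimes>\<^bsub>G\<^esub> inv\<^bsub>G\<^esub> x"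
        if "x \<in> carrier G" "y \<in> carrier G" for x y
      proof -
        have "g \<otimes>\<^bsub>G\<^esub> (inv\<^bsub>G\<^esub> g \<otimes>\<^bsub>G\<^esub> inv\<^bsub>G\<^esub> x) = inv\<^bsub>G\<^esub> x"
          using that \<open>g \<in> carrier G\<close> by (simp add: G.m_assoc[symmetric])
        then show ?thesis
          using that \<open>g \<in> carrier G\<close> by (simp add: G.inv_mult_group G.m_assoc)
      qed
      then show ?thesis
        using that right_mult_Bij[OF assms]
        by (auto simp: DigraphAut_def V mcay_verts_def right_mult_apply arc)
    qed
    ultimately show ?R using V by (auto simp: right_regular_def)
  next
    assume R: ?R
    then interpret pair_loopfree_digraph \<Sigma> by blast
    have V: "pverts \<Sigma> = mcay_verts G m" using R by blast
    define S where "S i j = {s \<in> carrier G. ((\<one>\<^bsub>G\<^esub>, i), (s, j)) \<in> parcs \<Sigma>}" for i j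
    have S: "connection_family G m S"
      using pair_no_loops by (force simp: connection_family_def S_def)
    have shift: "((x, i), (y, j)) \<in> parcs \<Sigma> \<longleftrightarrow> y \<otimes>\<^bsub>G\<^esub> inv\<^bsub>G\<^esub> x \<in> S i j"
      if "x \<in> carrier G" "y \<in> carrier G" "i \<in> {1..m}" "j \<in> {1..m}" for x y i j
    proof -
      have "right_mult G m x \<in> carrier (DigraphAut \<Sigma>)"
        using R that by (auto simp: right_regular_def)
      then have aut: "(right_mult G m x u, right_mult G m x v) \<in> parcs \<Sigma> \<longleftrightarrow> (u, v) \<in> parcs \<Sigma>"
        if "u \<in> mcay_verts G m" "v \<in> mcay_verts G m" for u v
        using that by (simp add: DigraphAut_def V)
      have "((\<one>\<^bsub>G\<^esub> \<otimes>\<^bsub>G\<^esub> x, i), (y \<otimes>\<^bsub>G\<^esub> inv\<^bsub>G\<^esub> x \<otimes>\<^bsub>G\<^esub> x, j)) \<in> parcs \<Sigma> \<longleftrightarrow>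
              ((\<one>\<^bsub>G\<^esub>, i), (y \<otimes>\<^bsub>G\<^esub> inv\<^bsub>G\<^esub> x, j)) \<in> parcs \<Sigma>"
        using aut[of "(\<one>\<^bsub>G\<^esub>, i)" "(y \<otimes>\<^bsub>G\<^esub> inv\<^bsub>G\<^esub> x, j)"] that
        unfolding mcay_verts_def by (simp add: right_mult_apply)
      then show ?thesis using that by (simp add: S_def G.m_assoc)
    qed
    have "\<Sigma> = mCay G m S"
    proof (rule pair_pre_digraph_eqI)
      show "pverts \<Sigma> = pverts (mCay G m S)" by (simp add: V mCay_def)
      have "((x, i), (y, j)) \<in> parcs \<Sigma> \<longleftrightarrow> ((x, i), (y, j)) \<in> parcs (mCay G m S)" for x i y j
        using shift in_arcsD1[of "(x, i)" "(y, j)"] in_arcsD2[of "(x, i)" "(y, j)"]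
        unfolding arc_mCay_iff[OF assms S] by (auto simp: V mcay_verts_def)
      then show "parcs \<Sigma> = parcs (mCay G m S)" by auto
    qed
    then show ?L using S by (auto simp: is_mcayley_digraph_def)
  }
qed

lemma is_mcayley_digraph_perm_image:
  assumes "group G" and "is_mcayley_digraph G m \<Gamma>" and "p \<in> Bij (mcay_verts G m)"
    and "right_regular G m \<subseteq> carrier (DigraphAut (digraph_perm_image p \<Gamma>))"
  shows "is_mcayley_digraph G m (digraph_perm_image p \<Gamma>)"
proof -
  have V: "pverts \<Gamma> = mcay_verts G m" and "pair_loopfree_digraph \<Gamma>"
    using assms(2) is_mcayley_digraph_iff[OF assms(1)] by auto
  interpret pair_loopfree_digraph \<Gamma> by fact
  have "pair_loopfree_digraph (digraph_perm_image p \<Gamma>)"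
    using assms(3) V by (intro pair_loopfree_digraph_perm_image) simp
  then show ?thesis
    using is_mcayley_digraph_iff[OF assms(1)] assms(4) V by simp
qed

text \<open>The two notions differ only in the class over which \<open>\<Sigma>\<close> ranges, and every digraph isomorphic
  to the graph \<open>\<Gamma>\<close> is a graph.\<close>

lemma mCI_graph_iff_mCI_digraph:
  assumes "group G" and "is_mcayley_graph G m \<Gamma>"
  shows "mCI_graph G m \<Gamma> \<longleftrightarrow> mCI_digraph G m \<Gamma>"
proof -
  have \<Gamma>: "pair_graph \<Gamma>" "is_mcayley_digraph G m \<Gamma>"
    using assms(2) by (auto simp: is_mcayley_graph_def)
  interpret pair_graph \<Gamma> by fact
  have "pair_graph \<Sigma>"
    if \<Sigma>: "is_mcayley_digraph G m \<Sigma>" and iso: "digraph_iso (with_proj \<Gamma>) (with_proj \<Sigma>)" for \<Sigma>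
  proof -
    have "pverts \<Sigma> = pverts \<Gamma>"
      using \<Gamma> \<Sigma> is_mcayley_digraph_iff[OF assms(1)] by auto
    then show ?thesis
      using iso digraph_iso_iff_perm_image pair_graph_perm_image[OF \<Gamma>(1)] by auto
  qed
  then show ?thesis
    using assms(2) \<Gamma> by (auto simp: mCI_graph_def mCI_digraph_def is_mcayley_graph_def)
qed

section \<open>The conjugacy criterion\<close>

text \<open>The \<open>m\<close>-Cayley digraphs isomorphic to \<open>\<Gamma>\<close> are the images of \<open>\<Gamma>\<close> under those permutations \<open>f\<close>
  for which \<open>f\<inverse> R f\<close> consists of automorphisms of \<open>\<Gamma>\<close>. The map \<open>f\<close> may be replaced by
  \<open>f a\<inverse>\<close> for any automorphism \<open>a\<close>, and \<open>f a\<inverse>\<close> normalizes \<open>R\<close> exactly when \<open>a\<close> conjugates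
  \<open>f\<inverse> R f\<close> to \<open>R\<close>. In the statement, \<open>p\<close> is \<open>f\<inverse>\<close>.\<close>

lemma mCI_digraph_iff_conjugates:
  assumes "group G" and "is_mcayley_digraph G m \<Gamma>"
  defines "B \<equiv> BijGroup (mcay_verts G m)" and "R \<equiv> right_regular G m"
  shows "mCI_digraph G m \<Gamma> \<longleftrightarrow>
         (\<forall>p\<in>carrier B. conj_set B p R \<subseteq> carrier (DigraphAut \<Gamma>) \<longrightarrow>
            (\<exists>a\<in>carrier (DigraphAut \<Gamma>). R = conj_set B a (conj_set B p R)))"
    (is "_ \<longleftrightarrow> ?C")
proof -
  interpret B: group B unfolding B_def by (rule group_BijGroup)
  have V: "pverts \<Gamma> = mcay_verts G m" and "pair_loopfree_digraph \<Gamma>"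
    using assms(2) is_mcayley_digraph_iff[OF assms(1)] by auto
  interpret pair_loopfree_digraph \<Gamma> by fact
  have R: "R \<subseteq> carrier B"
    using right_regular_subset[OF assms(1)] by (simp add: R_def B_def)
  have carrB: "carrier B = Bij (pverts \<Gamma>)" by (simp add: B_def V)
  have B: "B = BijGroup (pverts \<Gamma>)" by (simp add: B_def V)
  have Aut: "a \<in> carrier B" "digraph_perm_image a \<Gamma> = \<Gamma>" if "a \<in> carrier (DigraphAut \<Gamma>)" for a
    using that mem_DigraphAut_iff carrB by auto
  note conj = B.conj_set_conj_set[OF _ _ R]
  note image_mult = perm_image_mult[folded B carrB]
  note norm = B.mem_normalizer_iff[OF R]
  show ?thesis
  proof
    assume CI: "mCI_digraph G m \<Gamma>"
    show ?C
    proof (intro ballI impI)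
      fix p assume p: "p \<in> carrier B"
        and sub: "conj_set B p R \<subseteq> carrier (DigraphAut \<Gamma>)"
      let ?\<Sigma> = "digraph_perm_image (inv\<^bsub>B\<^esub> p) \<Gamma>"
      have ip: "inv\<^bsub>B\<^esub> p \<in> carrier B" using p by simp
      have "conj_set B (inv\<^bsub>B\<^esub> p) (conj_set B p R) = R"
        using B.conj_set_inv_eq_iff[OF p R B.conj_set_subset[OF p R]] by simp
      then have "R \<subseteq> carrier (DigraphAut ?\<Sigma>)"
        using conj_set_subset_DigraphAut[folded B carrB, OF ip sub] by simp
      then have "is_mcayley_digraph G m ?\<Sigma>"
        using is_mcayley_digraph_perm_image[OF assms(1,2)] ip carrB V R_def by auto
      moreover have "digraph_iso (with_proj \<Gamma>) (with_proj ?\<Sigma>)"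
        using digraph_iso_iff_perm_image ip carrB by auto
      ultimately obtain n where n: "n \<in> carrier B" "conj_set B n R = R"
        and image: "digraph_perm_image n \<Gamma> = ?\<Sigma>"
        using CI norm unfolding mCI_digraph_def B_def R_def by blast
      \<comment> \<open>Both \<open>n\<close> and \<open>p\<inverse>\<close> map \<open>\<Gamma>\<close> to the same digraph, so they differ by an automorphism.\<close>
      have "digraph_perm_image (p \<otimes>\<^bsub>B\<^esub> n) \<Gamma> = digraph_perm_image (p \<otimes>\<^bsub>B\<^esub> inv\<^bsub>B\<^esub> p) \<Gamma>"
        using image_mult[OF p n(1)] image_mult[OF p ip] image by simp
      also have "\<dots> = \<Gamma>"
        using p perm_image_one[folded B] by simp
      finally have "p \<otimes>\<^bsub>B\<^esub> n \<in> carrier (DigraphAut \<Gamma>)"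
        using mem_DigraphAut_iff carrB B.m_closed[OF p n(1)] by blast
      then have a: "inv\<^bsub>B\<^esub> (p \<otimes>\<^bsub>B\<^esub> n) \<in> carrier (DigraphAut \<Gamma>)"
        using subgroup.m_inv_closed[OF subgroup_DigraphAut] B by simp
      have "conj_set B p R = conj_set B (p \<otimes>\<^bsub>B\<^esub> n) R"
        using conj[OF p n(1)] n(2) by simp
      then have "R = conj_set B (inv\<^bsub>B\<^esub> (p \<otimes>\<^bsub>B\<^esub> n)) (conj_set B p R)"
        using B.conj_set_inv_eq_iff[OF B.m_closed[OF p n(1)] R B.conj_set_subset[OF p R]] by simp
      then show "\<exists>a\<in>carrier (DigraphAut \<Gamma>). R = conj_set B a (conj_set B p R)"
        using a by blast
    qed
  next
    assume C: ?C
    show "mCI_digraph G m \<Gamma>"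
      unfolding mCI_digraph_def
    proof (intro conjI allI impI; (elim conjE)?)
      fix \<Sigma> assume \<Sigma>: "is_mcayley_digraph G m \<Sigma>"
        and iso: "digraph_iso (with_proj \<Gamma>) (with_proj \<Sigma>)"
      have VS: "pverts \<Sigma> = pverts \<Gamma>" and "pair_loopfree_digraph \<Sigma>"
        and RS: "R \<subseteq> carrier (DigraphAut \<Sigma>)"
        using \<Sigma> is_mcayley_digraph_iff[OF assms(1)] V by (auto simp: R_def)
      interpret S: pair_loopfree_digraph \<Sigma> by fact
      obtain f where f: "f \<in> carrier B" and image: "digraph_perm_image f \<Gamma> = \<Sigma>"
        using iso digraph_iso_iff_perm_image[OF VS] carrB by auto
      have f': "inv\<^bsub>B\<^esub> f \<in> carrier B" using f by simp
      have "digraph_perm_image (inv\<^bsub>B\<^esub> f) \<Sigma> = \<Gamma>"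
        using perm_image_inv_eq_iff[folded B carrB, OF f S.pair_wf_digraph_axioms VS] image by simp
      then have "conj_set B (inv\<^bsub>B\<^esub> f) R \<subseteq> carrier (DigraphAut \<Gamma>)"
        using S.conj_set_subset_DigraphAut[unfolded VS, folded B carrB, OF f' RS] by simp
      then obtain a where a: "a \<in> carrier (DigraphAut \<Gamma>)"
        and conjR: "R = conj_set B a (conj_set B (inv\<^bsub>B\<^esub> f) R)"
        using C f' by blast
      have aB: "a \<in> carrier B" using Aut(1)[OF a] .
      have a': "inv\<^bsub>B\<^esub> a \<in> carrier (DigraphAut \<Gamma>)"
        using a subgroup.m_inv_closed[OF subgroup_DigraphAut] B by simp
      let ?n = "f \<otimes>\<^bsub>B\<^esub> inv\<^bsub>B\<^esub> a"
      have n: "?n \<in> carrier B" using f aB by simp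
      have inv_n: "inv\<^bsub>B\<^esub> ?n = a \<otimes>\<^bsub>B\<^esub> inv\<^bsub>B\<^esub> f"
        using f aB by (simp add: B.inv_mult_group)
      have "conj_set B (inv\<^bsub>B\<^esub> ?n) R = R"
        using conjR conj[OF aB f'] unfolding inv_n by simp
      then have "conj_set B ?n R = R"
        using B.conj_set_inv_eq_iff[OF n R R] by simp
      then have "?n \<in> normalizer B R" using norm n by blast
      moreover have "digraph_perm_image ?n \<Gamma> = \<Sigma>"
        using image_mult[OF f Aut(1)[OF a']] Aut(2)[OF a'] image by simp
      ultimately show "\<exists>n\<in>normalizer (BijGroup (mcay_verts G m)) (right_regular G m).
           digraph_perm_image n \<Gamma> = \<Sigma>"
        unfolding B_def R_def by blast
    qed (rule assms(2))
  qed
qed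

theorem theorem4p3:
  fixes G :: "('a, 'b) monoid_scheme" and m :: nat
    and S :: "nat \<Rightarrow> nat \<Rightarrow> 'a set" and \<Gamma> :: "('a \<times> nat) pair_pre_digraph"
  assumes "group G" and "finite (carrier G)" and "m \<ge> 1"
    and "connection_family G m S" and "\<Gamma> = mCay G m S"
  shows "(mCI_digraph G m \<Gamma> \<longleftrightarrow>
            (\<forall>H. subgroup H (DigraphAut \<Gamma>) \<and> semiregular (pverts \<Gamma>) H \<and>
                 DigraphAut \<Gamma>\<lparr>carrier := H\<rparr> \<cong> G \<longrightarrow>
                 conjugate_in (DigraphAut \<Gamma>) H (right_regular G m))) \<and>
         (is_mcayley_graph G m \<Gamma> \<longrightarrow>
           (mCI_graph G m \<Gamma> \<longleftrightarrow>
            (\<forall>H. subgroup H (DigraphAut \<Gamma>) \<and> semiregular (pverts \<Gamma>) H \<and>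
                 DigraphAut \<Gamma>\<lparr>carrier := H\<rparr> \<cong> G \<longrightarrow>
                 conjugate_in (DigraphAut \<Gamma>) H (right_regular G m))))"
proof -
  let ?B = "BijGroup (mcay_verts G m)" and ?R = "right_regular G m"
  let ?A = "DigraphAut \<Gamma>"
  have cay: "is_mcayley_digraph G m \<Gamma>"
    using assms(4,5) by (auto simp: is_mcayley_digraph_def)
  have V: "pverts \<Gamma> = mcay_verts G m" and "pair_loopfree_digraph \<Gamma>"
    using cay is_mcayley_digraph_iff[OF assms(1)] by auto
  interpret pair_loopfree_digraph \<Gamma> by fact
  interpret B: group ?B by (rule group_BijGroup)
  have A: "?A = ?B\<lparr>carrier := carrier ?A\<rparr>" by (simp add: DigraphAut_def V)
  have subA: "subgroup (carrier ?A) ?B" using subgroup_DigraphAut V by simp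
  have sub_iff: "subgroup H ?A \<longleftrightarrow> subgroup H ?B \<and> H \<subseteq> carrier ?A" for H
    using B.incl_subgroup[OF subA] B.subgroup_incl[OF _ subA] subgroup.subset[of H ?A] A by metis
  have conj_iff: "conjugate_in ?A H ?R \<longleftrightarrow>
      (\<exists>a\<in>carrier ?A. ?R = conj_set ?B a H)" for H
  proof -
    have "inv\<^bsub>?A\<^esub> a = inv\<^bsub>?B\<^esub> a" if "a \<in> carrier ?A" for a
      using B.m_inv_consistent[OF subA that] A by metis
    moreover have "monoid.mult ?A = monoid.mult ?B" by (simp add: DigraphAut_def V)
    ultimately show ?thesis
      unfolding conjugate_in_def conj_set_eq_image by simp
  qed
  have carrH: "?A\<lparr>carrier := H\<rparr> = ?B\<lparr>carrier := H\<rparr>" for H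
    by (simp add: DigraphAut_def V)
  have H_iff: "subgroup H ?A \<and> semiregular (pverts \<Gamma>) H \<and> ?A\<lparr>carrier := H\<rparr> \<cong> G \<longleftrightarrow>
      (\<exists>p\<in>carrier ?B. H = conj_set ?B p ?R) \<and> H \<subseteq> carrier ?A" for H
    unfolding sub_iff carrH V
    using semiregular_iff_conjugate_right_regular[OF assms(1-3), of H] by blast
  have main: "mCI_digraph G m \<Gamma> \<longleftrightarrow>
            (\<forall>H. subgroup H ?A \<and> semiregular (pverts \<Gamma>) H \<and> ?A\<lparr>carrier := H\<rparr> \<cong> G \<longrightarrow>
                 conjugate_in ?A H ?R)"
    unfolding mCI_digraph_iff_conjugates[OF assms(1) cay] H_iff conj_iff by blast
  then show ?thesis
    using mCI_graph_iff_mCI_digraph[OF assms(1)] by blast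
qed

end
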